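(* Let $S$ be a conical cup. A point $K$ of $S$ is the cone point of $S$ if and only if $K$ is an endpoint of every minimal path on $S$ containing it. Furthermore, every minimal path ending at the cone point lies in some plane containing the axis of revolution of $S$.
   Context: A conical cup with cone angle $\phi\in(0,\pi/2)$ and slant height $s=\csc\phi>1$ is the closed surface $S\subset\mathbb{R}^3$ which in cylindrical coordinates $[r,\vartheta,z]$ consists of the side $\{r=z\tan\phi,\ 0\le z\le h\}$ and the lid $\{r\le 1,\ z=h\}$, where $h=\cot\phi$; its cone point is the origin and its axis is the line $r=0$. A path on $S$ from $A$ to $B$ is a continuous map $\gamma:[a,b]\to S$ with $\gamma(a)=A$, $\gamma(b)=B$; it is minimal if its length is at most that of every path on $S$ from $A$ to $B$. The endpoints $A$ and $B$ of a minimal path are always assumed distinct. *)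

theory Defs
  imports "HOL-Analysis.Analysis"
begin

section \<open>Conical cups\<close>

definition cyl :: "real \<Rightarrow> real \<Rightarrow> real \<Rightarrow> real^3" where
  "cyl r \<theta> z = vector [r * cos \<theta>, r * sin \<theta>, z]"

text \<open>The cup is scaled so that its lid has radius 1; hence its height is
  \<open>cot \<phi>\<close> and its slant height is \<open>1 / sin \<phi>\<close>.\<close>

definition cup_side :: "real \<Rightarrow> (real^3) set" where
  "cup_side \<phi> = {cyl r \<theta> z | r \<theta> z. r = z * tan \<phi> \<and> 0 \<le> z \<and> z \<le> cot \<phi>}"

definition cup_lid :: "real \<Rightarrow> (real^3) set" where
  "cup_lid \<phi> = {cyl r \<theta> z | r \<theta> z. 0 \<le> r \<and> r \<le> 1 \<and> z = cot \<phi>}"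

definition conical_cup :: "real \<Rightarrow> (real^3) set" where
  "conical_cup \<phi> = cup_side \<phi> \<union> cup_lid \<phi>"

definition cone_point :: "real^3" where
  "cone_point = 0"

definition cup_axis :: "(real^3) set" where
  "cup_axis = {cyl r \<theta> z | r \<theta> z. r = 0}"

definition is_plane :: "(real^3) set \<Rightarrow> bool" where
  "is_plane P \<longleftrightarrow> affine P \<and> aff_dim P = 2"


section \<open>Paths, length, minimal paths\<close>

text \<open>A path is a function on \<open>{a..b}\<close>; its values outside that interval are irrelevant.\<close>

definition path_on :: "'a::metric_space set \<Rightarrow> real \<Rightarrow> real \<Rightarrow> (real \<Rightarrow> 'a) \<Rightarrow> 'a \<Rightarrow> 'a \<Rightarrow> bool" where
  "path_on S a b \<gamma> A B \<longleftrightarrow>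
     a \<le> b \<and> continuous_on {a..b} \<gamma> \<and> \<gamma> ` {a..b} \<subseteq> S \<and> \<gamma> a = A \<and> \<gamma> b = B"

text \<open>The pair \<open>(n, t)\<close> encodes the subdivision \<open>a = t 0 \<le> t 1 \<le> \<dots> \<le> t n = b\<close>.\<close>

definition subdivisions :: "real \<Rightarrow> real \<Rightarrow> (nat \<times> (nat \<Rightarrow> real)) set" where
  "subdivisions a b = {(n, t). t 0 = a \<and> t n = b \<and> (\<forall>i<n. t i \<le> t (Suc i))}"

text \<open>Length is the supremum of the lengths of inscribed polygons. It is extended-valued because
  a path is only required to be continuous, so it may fail to be rectifiable.\<close>

definition curve_length :: "real \<Rightarrow> real \<Rightarrow> (real \<Rightarrow> 'a::metric_space) \<Rightarrow> ennreal" where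
  "curve_length a b \<gamma> =
     (SUP (n, t)\<in>subdivisions a b. \<Sum>i<n. ennreal (dist (\<gamma> (t i)) (\<gamma> (t (Suc i)))))"

text \<open>Endpoints of a minimal path are distinct by convention. Competing paths may be
  parametrised over any compact interval.\<close>

definition minimal_path :: "'a::metric_space set \<Rightarrow> real \<Rightarrow> real \<Rightarrow> (real \<Rightarrow> 'a) \<Rightarrow> 'a \<Rightarrow> 'a \<Rightarrow> bool" where
  "minimal_path S a b \<gamma> A B \<longleftrightarrow>
     path_on S a b \<gamma> A B \<and> A \<noteq> B \<and>
     (\<forall>c d \<delta>. path_on S c d \<delta> A B \<longrightarrow> curve_length a b \<gamma> \<le> curve_length c d \<delta>)"

end

theory Submission
  imports Defs
begin

text \<open>
  A path from the cone point to a point \<open>X\<close> of the lid meets the rim, so its length is at least the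
  slant height plus the distance from \<open>X\<close> to the rim, and the meridian path attains this bound;
  for \<open>X\<close> on the side the bound is the Euclidean distance from the apex. Equality in the triangle
  inequality makes every minimal path from the cone point a union of at most two segments in a
  plane through the axis.

  A path that passes through the cone point on its way from \<open>A\<close> to \<open>B\<close> is therefore at least as long
  as the two meridians together. These can be shortened: unfolded, the cone has total angle less
  than \<open>2 * pi\<close>, so two points at distance \<open>\<rho>\<close> from the apex are joined by a chord shorter
  than \<open>2 * \<rho>\<close>. Any other point lies inside a meridian segment, inside a diameter of the lid,
  or is the rim point of the meridian path from the cone point to the centre of the lid.
\<close>

section \<open>Curve length and 1-Lipschitz paths\<close>

text \<open>Three interior vertices are the most that any later estimate uses. Subdivisions need
  only be weakly increasing, so repeating a vertex yields the bounds with fewer.\<close>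

lemma polygon_le_curve_length:
  assumes "a \<le> t1" "t1 \<le> t2" "t2 \<le> t3" "t3 \<le> b"
  shows "ennreal (dist (\<gamma> a) (\<gamma> t1) + dist (\<gamma> t1) (\<gamma> t2) + dist (\<gamma> t2) (\<gamma> t3) + dist (\<gamma> t3) (\<gamma> b))
    \<le> curve_length a b \<gamma>"
proof -
  define t where "t = (\<lambda>i::nat. [a, t1, t2, t3, b] ! i)"
  have tv: "t 0 = a" "t 1 = t1" "t 2 = t2" "t 3 = t3" "t 4 = b"
    by (auto simp: t_def)
  have "t i \<le> t (Suc i)" if "i < 4" for i
  proof -
    have "i = 0 \<or> i = 1 \<or> i = 2 \<or> i = 3"
      using that by auto
    then show ?thesis
      using assms by (auto simp: t_def)
  qed
  then have "(4, t) \<in> subdivisions a b"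
    by (simp add: subdivisions_def tv)
  then have "(\<Sum>i<4. ennreal (dist (\<gamma> (t i)) (\<gamma> (t (Suc i))))) \<le> curve_length a b \<gamma>"
    unfolding curve_length_def
    by (intro SUP_upper2[where i = "(4, t)"]) auto
  moreover have "{..<4} = {0, 1, 2, 3::nat}"
    by auto
  ultimately show ?thesis
    by (simp add: t_def add.assoc flip: ennreal_plus)
qed

lemma dist_le_curve_length:
  assumes "a \<le> t" "t \<le> b"
  shows "ennreal (dist (\<gamma> a) (\<gamma> t) + dist (\<gamma> t) (\<gamma> b)) \<le> curve_length a b \<gamma>"
  using polygon_le_curve_length[of a t t t b \<gamma>] assms by simp

lemma path_image_connected:
  fixes \<gamma> :: "real \<Rightarrow> 'a::topological_space"
  assumes "continuous_on {a..b} \<gamma>" "a \<le> c" "d \<le> b"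
  shows "connected (\<gamma> ` {c..d})"
  using assms continuous_on_subset[of "{a..b}" \<gamma> "{c..d}"]
  by (intro connected_continuous_image) auto

section \<open>Paths whose parameter bounds their length\<close>

text \<open>All competitors are built in this form: a 1-Lipschitz path on \<open>{0..L}\<close> has
  length at most \<open>L\<close>, so no length has to be computed exactly.\<close>

definition lip_path :: "'a::metric_space set \<Rightarrow> real \<Rightarrow> (real \<Rightarrow> 'a) \<Rightarrow> 'a \<Rightarrow> 'a \<Rightarrow> bool" where
  "lip_path S L \<gamma> A B \<longleftrightarrow>
     0 \<le> L \<and> 1-lipschitz_on {0..L} \<gamma> \<and> \<gamma> ` {0..L} \<subseteq> S \<and> \<gamma> 0 = A \<and> \<gamma> L = B"

lemma path_on_lip_path: "lip_path S L \<gamma> A B \<Longrightarrow> path_on S 0 L \<gamma> A B"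
  unfolding lip_path_def path_on_def
  using lipschitz_on_continuous_on by blast

lemma subdivision_mono:
  fixes t :: "nat \<Rightarrow> real"
  assumes "\<forall>i<n. t i \<le> t (Suc i)" "i \<le> j" "j \<le> n"
  shows "t i \<le> t j"
proof -
  have "j \<le> n \<Longrightarrow> t i \<le> t j"
    using assms(2)
  proof (induction rule: dec_induct)
    case (step k)
    then have "t i \<le> t k" "t k \<le> t (Suc k)"
      using assms(1) by auto
    then show ?case
      by (rule order.trans)
  qed simp
  then show ?thesis
    using assms(3) .
qed

text \<open>Each edge of an inscribed polygon is at most its parameter increment, and the increments
  telescope to \<open>L\<close>.\<close>

lemma curve_length_lip_path:
  assumes "lip_path S L \<gamma> A B"
  shows "curve_length 0 L \<gamma> \<le> ennreal L"
  unfolding curve_length_def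
proof (rule SUP_least, clarify)
  fix n t assume "(n, t) \<in> subdivisions 0 L"
  then have t: "t 0 = 0" "t n = L" "\<forall>i<n. t i \<le> t (Suc i)"
    by (auto simp: subdivisions_def)
  have mem: "t i \<in> {0..L}" if "i \<le> n" for i
    using subdivision_mono[OF t(3), of 0 i] subdivision_mono[OF t(3), of i n] that t by auto
  have "dist (\<gamma> (t i)) (\<gamma> (t (Suc i))) \<le> t (Suc i) - t i" if "i < n" for i
  proof -
    have "dist (\<gamma> (t i)) (\<gamma> (t (Suc i))) \<le> 1 * dist (t i) (t (Suc i))"
      using assms mem[of i] mem[of "Suc i"] that unfolding lip_path_def
      by (intro lipschitz_onD) auto
    then show ?thesis using t(3) that by (auto simp: dist_real_def)
  qed
  then have "(\<Sum>i<n. dist (\<gamma> (t i)) (\<gamma> (t (Suc i)))) \<le> (\<Sum>i<n. t (Suc i) - t i)"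
    by (intro sum_mono) auto
  also have "\<dots> = L"
    using t by (simp add: sum_lessThan_telescope)
  finally show "(\<Sum>i<n. ennreal (dist (\<gamma> (t i)) (\<gamma> (t (Suc i))))) \<le> ennreal L"
    by (subst sum_ennreal) (auto intro: ennreal_leI)
qed

lemma minimal_path_le_lip_path:
  assumes "minimal_path S a b \<gamma> A B" "lip_path S L \<delta> A B"
  shows "curve_length a b \<gamma> \<le> ennreal L"
proof -
  have "curve_length a b \<gamma> \<le> curve_length 0 L \<delta>"
    using assms(1) path_on_lip_path[OF assms(2)] unfolding minimal_path_def by blast
  then show ?thesis
    using curve_length_lip_path[OF assms(2)] by (rule order.trans)
qed

lemma lip_path_minimal:
  assumes "lip_path S L \<delta> A B" "A \<noteq> B"
    and lower: "\<And>a b \<gamma>. path_on S a b \<gamma> A B \<Longrightarrow> ennreal L \<le> curve_length a b \<gamma>"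
  shows "minimal_path S 0 L \<delta> A B"
  unfolding minimal_path_def
  using path_on_lip_path[OF assms(1)] assms(2)
    order.trans[OF curve_length_lip_path[OF assms(1)] lower] by blast

lemma straight_minimal:
  assumes "lip_path S L \<delta> A B" "A \<noteq> B" "L \<le> dist A B"
  shows "minimal_path S 0 L \<delta> A B"
proof (rule lip_path_minimal[OF assms(1,2)])
  fix a b \<gamma> assume p: "path_on S a b \<gamma> A B"
  then have "ennreal (dist A B) \<le> curve_length a b \<gamma>"
    using dist_le_curve_length[of a a b \<gamma>] by (simp add: path_on_def)
  then show "ennreal L \<le> curve_length a b \<gamma>"
    by (rule order.trans[OF ennreal_leI[OF assms(3)]])
qed

lemma lip_path_join:
  assumes "lip_path S L \<gamma> A B" "lip_path S M \<delta> B C"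
  shows "lip_path S (L + M) (\<lambda>t. if t \<le> L then \<gamma> t else \<delta> (t - L)) A C"
proof -
  have "(1 * 1)-lipschitz_on {L..L+M} (\<lambda>t. \<delta> (t - L))"
  proof (rule lipschitz_on_compose2[where f = "\<lambda>t. t - L"])
    show "1-lipschitz_on {L..L+M} (\<lambda>t. t - L)"
      by (rule lipschitz_onI) (auto simp: dist_real_def)
    show "1-lipschitz_on ((\<lambda>t. t - L) ` {L..L+M}) \<delta>"
      using assms(2) unfolding lip_path_def
      by (auto intro: lipschitz_on_subset)
  qed
  then have "1-lipschitz_on {0..L+M} (\<lambda>t. if t \<le> L then \<gamma> t else \<delta> (t - L))"
    using assms unfolding lip_path_def by (intro lipschitz_on_concat) auto
  moreover have "\<gamma> t \<in> S" if "0 \<le> t" "t \<le> L" for t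
    using assms(1) that unfolding lip_path_def by auto
  moreover have "\<delta> (t - L) \<in> S" if "\<not> t \<le> L" "t \<le> L + M" for t
    using assms(2) that unfolding lip_path_def image_subset_iff by auto
  \<comment> \<open>For \<open>M = 0\<close> the right end falls into the first branch, where
    \<open>\<gamma> L = B = C\<close>.\<close>
  moreover have "(if L + M \<le> L then \<gamma> (L + M) else \<delta> (L + M - L)) = C"
    using assms unfolding lip_path_def by (cases "M = 0") auto
  moreover have "0 \<le> L + M" "\<gamma> 0 = A" "0 \<le> L"
    using assms unfolding lip_path_def by auto
  ultimately show ?thesis
    unfolding lip_path_def image_subset_iff by auto
qed

lemma lip_path_reverse:
  assumes "lip_path S L \<gamma> A B"
  shows "lip_path S L (\<lambda>t. \<gamma> (L - t)) B A"
proof -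
  have "(1 * 1)-lipschitz_on {0..L} (\<lambda>t. \<gamma> (L - t))"
  proof (rule lipschitz_on_compose2[where f = "\<lambda>t. L - t"])
    show "1-lipschitz_on {0..L} (\<lambda>t. L - t)"
      by (rule lipschitz_onI) (auto simp: dist_real_def)
    show "1-lipschitz_on ((\<lambda>t. L - t) ` {0..L}) \<gamma>"
      using assms unfolding lip_path_def
      by (auto intro: lipschitz_on_subset)
  qed
  then show ?thesis
    using assms unfolding lip_path_def image_subset_iff by auto
qed

lemma lip_path_straight:
  fixes u :: "'a::real_normed_vector"
  assumes "norm u = 1" "0 \<le> L" "\<And>t. 0 \<le> t \<Longrightarrow> t \<le> L \<Longrightarrow> A + t *\<^sub>R u \<in> S"
    and "B = A + L *\<^sub>R u"
  shows "lip_path S L (\<lambda>t. A + t *\<^sub>R u) A B"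
proof -
  have "1-lipschitz_on {0..L} (\<lambda>t. A + t *\<^sub>R u)"
    by (rule lipschitz_onI)
      (auto simp: dist_norm assms(1) simp flip: scaleR_left_diff_distrib)
  then show ?thesis
    using assms unfolding lip_path_def by auto
qed

section \<open>The geometry of the cup\<close>

lemma cyl_nth [simp]:
  "cyl r \<theta> z $ 1 = r * cos \<theta>" "cyl r \<theta> z $ 2 = r * sin \<theta>" "cyl r \<theta> z $ 3 = z"
  by (simp_all add: cyl_def)

definition axis_dist :: "real^3 \<Rightarrow> real" where
  "axis_dist X = sqrt ((X$1)\<^sup>2 + (X$2)\<^sup>2)"

lemma axis_dist_cyl [simp]: "axis_dist (cyl r \<theta> z) = \<bar>r\<bar>"
  by (simp add: axis_dist_def power_mult_distrib flip: distrib_left)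

lemma norm_real3: "norm X = sqrt ((X$1)\<^sup>2 + (X$2)\<^sup>2 + (X$3)\<^sup>2)" for X :: "real^3"
  by (simp add: norm_vec_def L2_set_def sum_3)

lemma norm_cyl: "norm (cyl r \<theta> z) = sqrt (r\<^sup>2 + z\<^sup>2)"
  by (simp add: norm_real3 power_mult_distrib flip: distrib_left)

lemma real3_eqI: "X$1 = Y$1 \<Longrightarrow> X$2 = Y$2 \<Longrightarrow> X$3 = Y$3 \<Longrightarrow> X = Y" for X Y :: "real^3"
  by (simp add: vec_eq_iff forall_3)

text \<open>Polar coordinates on the cone: \<open>\<rho>\<close> is the distance from the apex along
  the generator at angle \<open>\<theta>\<close>. Unfolding the cone keeps \<open>\<rho>\<close> and
  multiplies angles by \<open>sin \<phi>\<close>.\<close>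

definition side_point :: "real \<Rightarrow> real \<Rightarrow> real \<Rightarrow> real^3" where
  "side_point \<phi> \<rho> \<theta> = cyl (\<rho> * sin \<phi>) \<theta> (\<rho> * cos \<phi>)"

lemma norm_side_point [simp]: "norm (side_point \<phi> \<rho> \<theta>) = \<bar>\<rho>\<bar>"
  by (simp add: side_point_def norm_cyl power_mult_distrib flip: distrib_left)

lemma side_point_add: "side_point \<phi> (\<rho> + t) \<theta> = side_point \<phi> \<rho> \<theta> + t *\<^sub>R side_point \<phi> 1 \<theta>"
  by (rule real3_eqI) (auto simp: side_point_def algebra_simps)

lemma cyl_add: "cyl (r + t) \<theta> z = cyl r \<theta> z + t *\<^sub>R cyl 1 \<theta> 0"
  by (rule real3_eqI) (auto simp: algebra_simps)

lemma side_point_0 [simp]: "side_point \<phi> 0 \<theta> = 0"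
  by (rule real3_eqI) (auto simp: side_point_def)

section \<open>Comparing the cone with its planar unfolding\<close>

text \<open>The difference of the two sides vanishes at 0, and its derivative
  \<open>k * cos (k * x) - k * cos x\<close> is nonnegative because cosine decreases on
  \<open>{0..pi}\<close>.\<close>

lemma sin_mult_ge:
  fixes k y :: real
  assumes "0 \<le> k" "k \<le> 1" "0 \<le> y" "y \<le> pi / 2"
  shows "k * sin y \<le> sin (k * y)"
proof -
  let ?f = "\<lambda>y. sin (k * y) - k * sin y"
  have "?f 0 \<le> ?f y"
  proof (rule DERIV_nonneg_imp_nondecreasing[OF assms(3)])
    fix x assume x: "0 \<le> x" "x \<le> y"
    have "(?f has_real_derivative k * cos (k * x) - k * cos x) (at x)"
      by (auto intro!: derivative_eq_intros)
    moreover have "cos x \<le> cos (k * x)"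
      using assms x by (intro cos_monotone_0_pi_le) (auto intro: mult_left_le_one_le)
    then have "0 \<le> k * cos (k * x) - k * cos x"
      using assms by (simp add: mult_left_mono)
    ultimately show "\<exists>D. (?f has_real_derivative D) (at x) \<and> 0 \<le> D"
      by blast
  qed
  then show ?thesis by simp
qed

text \<open>Both squares are even in \<open>y\<close>, so the sign condition disappears; squared
  sines are what \<open>dist_side_point\<close> contains.\<close>

lemma sin_mult_square_ge:
  fixes k y :: real
  assumes "0 \<le> k" "k \<le> 1" "\<bar>y\<bar> \<le> pi / 2"
  shows "(k * sin y)\<^sup>2 \<le> (sin (k * y))\<^sup>2"
proof -
  have "(k * sin \<bar>y\<bar>)\<^sup>2 \<le> (sin (k * \<bar>y\<bar>))\<^sup>2"
    using assms by (intro power_mono sin_mult_ge mult_nonneg_nonneg sin_ge_zero) auto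
  then show ?thesis
    by (cases "0 \<le> y") auto
qed

lemma cos_half_square: "cos x = 1 - 2 * (sin (x / 2))\<^sup>2" for x :: real
  using cos_double_sin[of "x / 2"] by simp

text \<open>The law of cosines in half-angle form. For the unfolded points in the plane the same
  formula holds with \<open>sin (sin \<phi> * ((\<theta> - \<theta>') / 2))\<close> in place of
  \<open>sin \<phi> * sin ((\<theta> - \<theta>') / 2)\<close>, so comparing the two distances
  reduces to comparing these sines.\<close>

lemma dist_side_point:
  "(dist (side_point \<phi> \<rho> \<theta>) (side_point \<phi> \<rho>' \<theta>'))\<^sup>2
     = (\<rho> - \<rho>')\<^sup>2 + 4 * \<rho> * \<rho>' * (sin \<phi> * sin ((\<theta> - \<theta>') / 2))\<^sup>2"
proof -
  have "(dist (side_point \<phi> \<rho> \<theta>) (side_point \<phi> \<rho>' \<theta>'))\<^sup>2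
     = (\<rho> * sin \<phi> * cos \<theta> - \<rho>' * sin \<phi> * cos \<theta>')\<^sup>2
       + (\<rho> * sin \<phi> * sin \<theta> - \<rho>' * sin \<phi> * sin \<theta>')\<^sup>2 + (\<rho> * cos \<phi> - \<rho>' * cos \<phi>)\<^sup>2"
    by (simp add: dist_norm norm_real3 side_point_def)
  also have "\<dots> = (sin \<phi>)\<^sup>2 * (\<rho>\<^sup>2 * ((cos \<theta>)\<^sup>2 + (sin \<theta>)\<^sup>2) + \<rho>'\<^sup>2 * ((cos \<theta>')\<^sup>2 + (sin \<theta>')\<^sup>2)
       - 2 * \<rho> * \<rho>' * cos (\<theta> - \<theta>')) + (cos \<phi>)\<^sup>2 * (\<rho> - \<rho>')\<^sup>2"
    unfolding cos_diff by algebra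
  also have "\<dots> = ((cos \<phi>)\<^sup>2 + (sin \<phi>)\<^sup>2) * (\<rho> - \<rho>')\<^sup>2 + 2 * \<rho> * \<rho>' * (sin \<phi>)\<^sup>2 * (1 - cos (\<theta> - \<theta>'))"
    using sin_cos_squared_add2[of \<phi>] sin_cos_squared_add2[of \<theta>] sin_cos_squared_add2[of \<theta>']
    by algebra
  also have "\<dots> = (\<rho> - \<rho>')\<^sup>2 + 4 * \<rho> * \<rho>' * (sin \<phi> * sin ((\<theta> - \<theta>') / 2))\<^sup>2"
    unfolding cos_half_square[of "\<theta> - \<theta>'"] sin_cos_squared_add2
    by (simp add: power_mult_distrib algebra_simps)
  finally show ?thesis .
qed

lemma polar_arctan:
  assumes "0 < (x::real)"
  shows "sqrt (x\<^sup>2 + y\<^sup>2) * cos (arctan (y / x)) = x" "sqrt (x\<^sup>2 + y\<^sup>2) * sin (arctan (y / x)) = y"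
proof -
  have pos: "0 < 1 + (y / x)\<^sup>2"
    by (simp add: add_pos_nonneg)
  have "x\<^sup>2 + y\<^sup>2 = x\<^sup>2 * (1 + (y / x)\<^sup>2)"
    using assms by (simp add: field_simps)
  then have "sqrt (x\<^sup>2 + y\<^sup>2) = x * sqrt (1 + (y / x)\<^sup>2)"
    using assms by (simp add: real_sqrt_mult)
  then show "sqrt (x\<^sup>2 + y\<^sup>2) * cos (arctan (y / x)) = x" "sqrt (x\<^sup>2 + y\<^sup>2) * sin (arctan (y / x)) = y"
    using assms pos by (simp_all add: cos_arctan sin_arctan)
qed

context
  fixes \<phi> :: real
  assumes \<phi>: "0 < \<phi>" "\<phi> < pi / 2"
begin

lemma sin_cos_pos: "0 < sin \<phi>" "0 < cos \<phi>" "sin \<phi> < 1"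
  using \<phi> sin_gt_zero[of \<phi>] cos_gt_zero[of \<phi>] sin_monotone_2pi[of \<phi> "pi / 2"] by auto

lemma cot_pos: "0 < cot \<phi>"
  using sin_cos_pos by (simp add: cot_def)

lemma rim_side_point: "side_point \<phi> (1 / sin \<phi>) \<theta> = cyl 1 \<theta> (cot \<phi>)"
  using sin_cos_pos by (simp add: side_point_def cot_def)

lemma side_point_in_cup: "0 \<le> \<rho> \<Longrightarrow> \<rho> \<le> 1 / sin \<phi> \<Longrightarrow> side_point \<phi> \<rho> \<theta> \<in> conical_cup \<phi>"
  using sin_cos_pos unfolding conical_cup_def cup_side_def side_point_def
  by (intro UnI1 CollectI exI[of _ "\<rho> * sin \<phi>"] exI[of _ \<theta>] exI[of _ "\<rho> * cos \<phi>"])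
    (auto simp: tan_def cot_def field_simps)

lemma lid_point_in_cup:
  assumes "\<bar>r\<bar> \<le> 1"
  shows "cyl r \<theta> (cot \<phi>) \<in> conical_cup \<phi>"
proof (cases "0 \<le> r")
  case True
  then show ?thesis
    using assms unfolding conical_cup_def cup_lid_def by auto
next
  case False
  have "cyl r \<theta> (cot \<phi>) = cyl (-r) (\<theta> + pi) (cot \<phi>)"
    by (rule real3_eqI) auto
  then show ?thesis
    using assms False unfolding conical_cup_def cup_lid_def by auto
qed

lemma conical_cup_cases:
  assumes "X \<in> conical_cup \<phi>"
  obtains (side) \<rho> \<theta> where "0 \<le> \<rho>" "\<rho> \<le> 1 / sin \<phi>" "X = side_point \<phi> \<rho> \<theta>"
  | (lid) r \<theta> where "0 \<le> r" "r \<le> 1" "X = cyl r \<theta> (cot \<phi>)"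
proof -
  consider \<theta> z where "0 \<le> z" "z \<le> cot \<phi>" "X = cyl (z * tan \<phi>) \<theta> z"
    | r \<theta> where "0 \<le> r" "r \<le> 1" "X = cyl r \<theta> (cot \<phi>)"
    using assms unfolding conical_cup_def cup_side_def cup_lid_def by auto
  then show ?thesis
  proof cases
    case 1
    \<comment> \<open>\<open>z / cos \<phi>\<close> turns a height into the distance from the apex
      along the generator.\<close>
    then show ?thesis
      using sin_cos_pos
      by (intro side[of "z / cos \<phi>" \<theta>])
        (auto simp: side_point_def tan_def cot_def field_simps)
  qed (rule lid)
qed

text \<open>The intrinsic distance from the cone point. Both cases give \<open>1 / sin \<phi>\<close> on the rim.\<close>

definition apex_dist :: "real^3 \<Rightarrow> real" where
  "apex_dist X = (if X$3 < cot \<phi> then norm X else 1 / sin \<phi> + 1 - axis_dist X)"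

lemma apex_dist_lid: "0 \<le> r \<Longrightarrow> apex_dist (cyl r \<theta> (cot \<phi>)) = 1 / sin \<phi> + 1 - r"
  by (simp add: apex_dist_def)

lemma apex_dist_side:
  assumes "0 \<le> \<rho>" "\<rho> \<le> 1 / sin \<phi>"
  shows "apex_dist (side_point \<phi> \<rho> \<theta>) = \<rho>"
proof (cases "\<rho> = 1 / sin \<phi>")
  case True
  then show ?thesis
    using apex_dist_lid[of 1 \<theta>] rim_side_point by simp
next
  case False
  then have "side_point \<phi> \<rho> \<theta> $ 3 < cot \<phi>"
    using assms sin_cos_pos by (auto simp: side_point_def cot_def field_simps)
  then show ?thesis
    using assms by (simp add: apex_dist_def)
qed

section \<open>Paths from the cone point: crossing the rim and length\<close>

text \<open>Intermediate value theorem. In the function \<open>g\<close> below,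
  \<open>axis_dist\<close> cancels \<open>Y$3 * tan \<phi>\<close> on the side, leaving
  \<open>Y$3 - cot \<phi>\<close>; on the lid the first two terms cancel, leaving one minus the
  radius.\<close>

lemma rim_separates:
  assumes "connected C" "C \<subseteq> conical_cup \<phi>" "0 \<in> C" "X \<in> C" "X$3 = cot \<phi>"
  obtains \<theta> where "cyl 1 \<theta> (cot \<phi>) \<in> C"
proof -
  \<comment> \<open>negative on the open side, zero on the rim, positive on the open lid\<close>
  define g where "g Y = Y$3 - cot \<phi> + Y$3 * tan \<phi> - axis_dist Y" for Y
  have "continuous_on C g"
    unfolding g_def axis_dist_def by (intro continuous_intros)
  then have "is_interval (g ` C)"
    using assms(1) by (simp add: is_interval_connected_1 connected_continuous_image)
  moreover have "g 0 \<le> 0"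
    using cot_pos by (simp add: g_def axis_dist_def)
  moreover have "0 \<le> g X"
    using subsetD[OF assms(2,4)]
  proof (cases rule: conical_cup_cases)
    case (side \<rho> \<theta>)
    then have "\<rho> * sin \<phi> = 1"
      using assms(5) sin_cos_pos by (auto simp: side_point_def cot_def field_simps)
    then show ?thesis
      using side assms(5) sin_cos_pos by (auto simp: g_def side_point_def tan_def cot_def)
  next
    case (lid r \<theta>)
    then show ?thesis
      using sin_cos_pos by (auto simp: g_def tan_def cot_def)
  qed
  ultimately have "0 \<in> g ` C"
    using assms(3,4) by (meson imageI mem_is_interval_1_I)
  then obtain R where R: "R \<in> C" "g R = 0"
    by auto
  from subsetD[OF assms(2) R(1)] obtain \<theta> where "R = cyl 1 \<theta> (cot \<phi>)"
  proof (cases rule: conical_cup_cases)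
    case (side \<rho> \<theta>)
    then have "\<rho> = 1 / sin \<phi>"
      using R(2) sin_cos_pos by (auto simp: g_def side_point_def tan_def cot_def field_simps)
    then show ?thesis
      using side that rim_side_point by auto
  next
    case (lid r \<theta>)
    then show ?thesis
      using R(2) sin_cos_pos that by (auto simp: g_def tan_def cot_def)
  qed
  then show ?thesis
    using R that by auto
qed

text \<open>\<open>R\<close> is \<open>X\<close> itself on the side and a crossing point of the rim
  on the lid. Connected sets replace paths so that either half of a path can serve as
  \<open>C\<close>. The last two conclusions prepare the planarity claim: \<open>R\<close> off the
  axis spans a plane with it, and equality puts \<open>X\<close> into that plane.\<close>

lemma apex_dist_le:
  assumes "connected C" "C \<subseteq> conical_cup \<phi>" "0 \<in> C" "X \<in> C"
  obtains R where "R \<in> C" "apex_dist X \<le> norm R + dist R X"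
    "X \<noteq> 0 \<Longrightarrow> R$1 \<noteq> 0 \<or> R$2 \<noteq> 0"
    "norm R + dist R X \<le> apex_dist X \<Longrightarrow> R$1 * X$2 = R$2 * X$1"
  using subsetD[OF assms(2,4)]
proof (cases rule: conical_cup_cases)
  case (side \<rho> \<theta>)
  have "X$1 \<noteq> 0 \<or> X$2 \<noteq> 0" if "X \<noteq> 0"
  proof -
    have "\<rho> \<noteq> 0"
      using that side by auto
    then show ?thesis
      using side sin_cos_pos sin_zero_norm_cos_one[of \<theta>] by (auto simp: side_point_def)
  qed
  then show ?thesis
    using that[of X] assms side apex_dist_side[of \<rho> \<theta>] by (simp add: mult.commute)
next
  case (lid r \<theta>)
  then obtain \<theta>' where R: "cyl 1 \<theta>' (cot \<phi>) \<in> C"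
    using rim_separates[OF assms] by auto
  define R where "R = cyl 1 \<theta>' (cot \<phi>)"
  have nR: "norm R = 1 / sin \<phi>"
    using norm_side_point[of \<phi> "1 / sin \<phi>" \<theta>'] sin_cos_pos by (simp add: R_def rim_side_point)
  \<comment> \<open>The cosine of the angle between \<open>R\<close> and \<open>X\<close> about the
    axis; the excess of the squared distance over \<open>(1 - r)\<^sup>2\<close> will be
    \<open>2 * r * (1 - c)\<close>.\<close>
  define c where "c = cos \<theta>' * cos \<theta> + sin \<theta>' * sin \<theta>"
  have c: "c \<le> 1"
    using cos_le_one[of "\<theta>' - \<theta>"] by (simp add: c_def cos_diff)
  have "dist R X = sqrt ((cos \<theta>' - r * cos \<theta>)\<^sup>2 + (sin \<theta>' - r * sin \<theta>)\<^sup>2)"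
    by (simp add: dist_norm norm_real3 R_def lid)
  also have "(cos \<theta>' - r * cos \<theta>)\<^sup>2 + (sin \<theta>' - r * sin \<theta>)\<^sup>2
      = ((cos \<theta>')\<^sup>2 + (sin \<theta>')\<^sup>2) + r\<^sup>2 * ((cos \<theta>)\<^sup>2 + (sin \<theta>)\<^sup>2) - 2 * r * c"
    unfolding c_def by algebra
  finally have d: "dist R X = sqrt ((1 - r)\<^sup>2 + 2 * r * (1 - c))"
    unfolding sin_cos_squared_add2 by (simp add: power2_eq_square algebra_simps)
  have "apex_dist X = norm R + (1 - r)"
    using lid apex_dist_lid nR by simp
  moreover have "1 - r \<le> dist R X"
    unfolding d using lid c by (intro real_le_rsqrt) auto
  moreover have "R$1 * X$2 = R$2 * X$1" if "dist R X \<le> 1 - r"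
  proof -
    have "(dist R X)\<^sup>2 \<le> (1 - r)\<^sup>2"
      using that by (intro power_mono) auto
    moreover have "0 \<le> (1 - r)\<^sup>2 + 2 * r * (1 - c)"
      using lid c by auto
    ultimately have "r * (1 - c) \<le> 0"
      unfolding d by simp
    \<comment> \<open>Equality leaves two cases: \<open>X\<close> is the centre of the lid, or it
      lies on the radius to \<open>R\<close>.\<close>
    then have "r = 0 \<or> c = 1"
      using lid(1) c by (smt (verit) mult_pos_pos)
    moreover have "sin (\<theta>' - \<theta>) = 0" if "c = 1"
      using that sin_cos_squared_add[of "\<theta>' - \<theta>"] by (simp add: c_def cos_diff)
    ultimately show ?thesis
      by (auto simp: R_def lid sin_diff)
  qed
  moreover have "R$1 \<noteq> 0 \<or> R$2 \<noteq> 0"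
    using sin_zero_norm_cos_one[of \<theta>'] by (auto simp: R_def)
  ultimately show ?thesis
    using that[of R] R by (auto simp: R_def)
qed

text \<open>The path is the image, under folding, of the straight chord that subtends the angle
  \<open>2 * \<beta>\<close> at the apex of the unfolded cone; folding divides polar angles by \<open>sin \<phi>\<close>. On that chord
  it does not increase distances, because \<open>k * sin y \<le> sin (k * y)\<close> for \<open>0 \<le> k \<le> 1\<close> and
  \<open>0 \<le> y \<le> pi / 2\<close>; this is why \<open>\<beta> \<le> sin \<phi> * (pi / 2)\<close> is required.\<close>

lemma lip_path_chord:
  assumes "0 < \<rho>" "\<rho> \<le> 1 / sin \<phi>" "0 \<le> \<beta>" "\<beta> < pi / 2" "\<beta> \<le> sin \<phi> * (pi / 2)"
  shows "\<exists>\<gamma>. lip_path (conical_cup \<phi>) (2 * \<rho> * sin \<beta>) \<gamma>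
    (side_point \<phi> \<rho> (\<theta> - \<beta> / sin \<phi>)) (side_point \<phi> \<rho> (\<theta> + \<beta> / sin \<phi>))"
proof -
  have k: "0 < sin \<phi>" "sin \<phi> < 1"
    using sin_cos_pos by auto
  \<comment> \<open>The chord in the plane is the vertical segment at distance \<open>x\<close> from
    the apex; \<open>y\<close> is measured from its midpoint, and \<open>R y\<close>,
    \<open>\<alpha> y\<close> are the polar coordinates of the point \<open>(x, y)\<close>.\<close>
  define x where "x = \<rho> * cos \<beta>"
  define R where "R y = sqrt (x\<^sup>2 + y\<^sup>2)" for y
  define \<alpha> where "\<alpha> y = arctan (y / x)" for y
  define p where "p y = side_point \<phi> (R y) (\<theta> + \<alpha> y / sin \<phi>)" for y
  have sc: "0 \<le> sin \<beta>" "0 < cos \<beta>"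
    using assms by (auto intro: sin_ge_zero cos_gt_zero_pi)
  have x: "0 < x"
    using assms sc by (simp add: x_def)
  have tan: "\<rho> * sin \<beta> / x = tan \<beta>"
    using assms by (simp add: x_def tan_def)
  have R0: "0 \<le> R y" for y
    by (simp add: R_def)
  have R2: "(R y)\<^sup>2 = x\<^sup>2 + y\<^sup>2" for y
    by (simp add: R_def)
  have \<rho>2: "x\<^sup>2 + (\<rho> * sin \<beta>)\<^sup>2 = \<rho>\<^sup>2"
    by (simp add: x_def power_mult_distrib flip: distrib_left)
  have \<alpha>\<beta>: "\<alpha> (\<rho> * sin \<beta>) = \<beta>"
    using assms unfolding \<alpha>_def tan by (intro arctan_tan) auto
  have \<alpha>: "\<bar>\<alpha> y\<bar> \<le> \<beta>" if "\<bar>y\<bar> \<le> \<rho> * sin \<beta>" for y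
  proof -
    have "\<alpha> y \<le> \<alpha> (\<rho> * sin \<beta>)" "\<alpha> (- y) \<le> \<alpha> (\<rho> * sin \<beta>)"
      using that x unfolding \<alpha>_def by (intro arctan_monotone' divide_right_mono; simp)+
    then show ?thesis
      unfolding \<alpha>\<beta> by (simp add: \<alpha>_def arctan_minus)
  qed
  have lip: "dist (p y) (p z) \<le> \<bar>y - z\<bar>" if yz: "\<bar>y\<bar> \<le> \<rho> * sin \<beta>" "\<bar>z\<bar> \<le> \<rho> * sin \<beta>" for y z
  proof -
    \<comment> \<open>Both angles are at most \<open>\<beta>\<close> in absolute value, so half
      their folded difference stays within the range of \<open>sin_mult_square_ge\<close>.\<close>
    have "\<bar>\<alpha> y - \<alpha> z\<bar> \<le> sin \<phi> * pi"
      using \<alpha>[OF yz(1)] \<alpha>[OF yz(2)] assms(5) by linarith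
    then have "\<bar>(\<alpha> y / sin \<phi> - \<alpha> z / sin \<phi>) / 2\<bar> \<le> pi / 2"
      using k by (simp add: abs_mult field_simps flip: diff_divide_distrib)
    moreover have "sin \<phi> * ((\<alpha> y / sin \<phi> - \<alpha> z / sin \<phi>) / 2) = (\<alpha> y - \<alpha> z) / 2"
      using k by (simp add: field_simps)
    ultimately have le: "(sin \<phi> * sin ((\<alpha> y / sin \<phi> - \<alpha> z / sin \<phi>) / 2))\<^sup>2 \<le> (sin ((\<alpha> y - \<alpha> z) / 2))\<^sup>2"
      using sin_mult_square_ge[of "sin \<phi>" "(\<alpha> y / sin \<phi> - \<alpha> z / sin \<phi>) / 2"] k by simp
    have "(dist (p y) (p z))\<^sup>2
        = (R y - R z)\<^sup>2 + 4 * R y * R z * (sin \<phi> * sin ((\<alpha> y / sin \<phi> - \<alpha> z / sin \<phi>) / 2))\<^sup>2"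
      unfolding p_def dist_side_point by simp
    also have "\<dots> \<le> (R y - R z)\<^sup>2 + 4 * R y * R z * (sin ((\<alpha> y - \<alpha> z) / 2))\<^sup>2"
      using le R0 by (intro add_left_mono mult_left_mono) auto
    also have "\<dots> = (R y - R z)\<^sup>2 + 2 * R y * R z * (1 - cos (\<alpha> y - \<alpha> z))"
      unfolding cos_half_square[of "\<alpha> y - \<alpha> z"] by simp
    also have "\<dots> = (R y)\<^sup>2 + (R z)\<^sup>2 - 2 * ((R y * cos (\<alpha> y)) * (R z * cos (\<alpha> z)))
        - 2 * ((R y * sin (\<alpha> y)) * (R z * sin (\<alpha> z)))"
      unfolding cos_diff by algebra
    \<comment> \<open>Back to Cartesian coordinates: both points have abscissa \<open>x\<close>, so
      only the difference of ordinates survives.\<close>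
    also have "\<dots> = (y - z)\<^sup>2"
      unfolding R2 unfolding R_def \<alpha>_def polar_arctan[OF x] by algebra
    finally show ?thesis
      using abs_le_square_iff[of "dist (p y) (p z)" "y - z"] by simp
  qed
  have "1-lipschitz_on {0..2 * \<rho> * sin \<beta>} (\<lambda>t. p (t - \<rho> * sin \<beta>))"
  proof (rule lipschitz_onI)
    fix t u assume "t \<in> {0..2 * \<rho> * sin \<beta>}" "u \<in> {0..2 * \<rho> * sin \<beta>}"
    then show "dist (p (t - \<rho> * sin \<beta>)) (p (u - \<rho> * sin \<beta>)) \<le> 1 * dist t u"
      using lip[of "t - \<rho> * sin \<beta>" "u - \<rho> * sin \<beta>"] by (simp add: dist_real_def abs_le_iff)
  qed simp
  moreover have "p y \<in> conical_cup \<phi>" if "\<bar>y\<bar> \<le> \<rho> * sin \<beta>" for y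
  proof -
    have "y\<^sup>2 \<le> (\<rho> * sin \<beta>)\<^sup>2"
      using that by (simp add: abs_le_square_iff[symmetric])
    then have "(R y)\<^sup>2 \<le> \<rho>\<^sup>2"
      using R2[of y] \<rho>2 by simp
    then have "R y \<le> \<rho>"
      using assms(1) by (auto intro: power2_le_imp_le)
    then have "R y \<le> 1 / sin \<phi>"
      using assms(2) by (rule order.trans)
    then show ?thesis
      using R0 unfolding p_def by (intro side_point_in_cup)
  qed
  moreover have "R (\<rho> * sin \<beta>) = \<rho>" "R (- (\<rho> * sin \<beta>)) = \<rho>"
    using assms(1) \<rho>2 by (auto simp: R_def)
  moreover have "\<alpha> (- (\<rho> * sin \<beta>)) = - \<beta>"
    using \<alpha>\<beta> by (simp add: \<alpha>_def arctan_minus)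
  ultimately show ?thesis
    using \<alpha>\<beta> assms(1) sc
    by (intro exI[of _ "\<lambda>t. p (t - \<rho> * sin \<beta>)"]) (auto simp: lip_path_def p_def[of "\<rho> * sin \<beta>"] p_def[of "- (\<rho> * sin \<beta>)"])
qed

text \<open>Two generators differ by an angle of at most \<open>pi\<close>, which unfolds to at most
  \<open>sin \<phi> * pi\<close>, less than a straight angle. Hence the half-angle
  \<open>\<beta>\<close> has \<open>sin \<beta> < 1\<close>, and the chord
  \<open>2 * \<rho> * sin \<beta>\<close> beats the detour through the apex.\<close>

lemma lip_path_shortcut:
  assumes "0 < \<rho>" "\<rho> \<le> 1 / sin \<phi>"
  obtains L \<gamma> where "L < 2 * \<rho>" "lip_path (conical_cup \<phi>) L \<gamma> (side_point \<phi> \<rho> \<theta>) (side_point \<phi> \<rho> \<theta>')"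
proof -
  have k: "0 < sin \<phi>" "sin \<phi> < 1"
    using sin_cos_pos by auto
  \<comment> \<open>The nearest number of full turns; removing them leaves a difference
    \<open>d\<close> in \<open>{-pi..pi}\<close>.\<close>
  define n where "n = round ((\<theta>' - \<theta>) / (2 * pi))"
  define d where "d = \<theta>' - \<theta> - 2 * pi * of_int n"
  have "\<bar>of_int n - (\<theta>' - \<theta>) / (2 * pi)\<bar> * (2 * pi) \<le> 1 / 2 * (2 * pi)"
    unfolding n_def by (intro mult_right_mono of_int_round_abs_le) auto
  also have "\<bar>of_int n - (\<theta>' - \<theta>) / (2 * pi)\<bar> * (2 * pi) = \<bar>(of_int n - (\<theta>' - \<theta>) / (2 * pi)) * (2 * pi)\<bar>"
    by (simp add: abs_mult)
  also have "(of_int n - (\<theta>' - \<theta>) / (2 * pi)) * (2 * pi) = - d"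
    by (simp add: d_def field_simps)
  finally have d: "\<bar>d\<bar> \<le> pi"
    by simp
  have "sin \<theta>' = sin (\<theta> + d) \<and> cos \<theta>' = cos (\<theta> + d)"
    unfolding sin_cos_eq_iff d_def by (auto intro: exI[of _ n])
  then have \<theta>': "side_point \<phi> \<rho> \<theta>' = side_point \<phi> \<rho> (\<theta> + d)"
    by (simp add: side_point_def cyl_def)
  define \<beta> where "\<beta> = sin \<phi> * (\<bar>d\<bar> / 2)"
  have \<beta>: "0 \<le> \<beta>" "\<beta> \<le> sin \<phi> * (pi / 2)"
    unfolding \<beta>_def using d k by (auto intro!: mult_left_mono)
  moreover have "sin \<phi> * (pi / 2) < 1 * (pi / 2)"
    using k by (intro mult_strict_right_mono) auto
  ultimately have "\<beta> < pi / 2"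
    by linarith
  then have "sin \<beta> < 1"
    using \<beta> sin_monotone_2pi[of \<beta> "pi / 2"] by auto
  then have L: "2 * \<rho> * sin \<beta> < 2 * \<rho>"
    using assms by simp
  obtain \<gamma> where "lip_path (conical_cup \<phi>) (2 * \<rho> * sin \<beta>) \<gamma>
      (side_point \<phi> \<rho> (\<theta> + d / 2 - \<beta> / sin \<phi>)) (side_point \<phi> \<rho> (\<theta> + d / 2 + \<beta> / sin \<phi>))"
    using lip_path_chord[OF assms \<beta>(1) \<open>\<beta> < pi / 2\<close> \<beta>(2)] by blast
  then have \<gamma>: "lip_path (conical_cup \<phi>) (2 * \<rho> * sin \<beta>) \<gamma>
      (side_point \<phi> \<rho> (\<theta> + d / 2 - \<bar>d\<bar> / 2)) (side_point \<phi> \<rho> (\<theta> + d / 2 + \<bar>d\<bar> / 2))"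
    using k by (simp add: \<beta>_def)
  \<comment> \<open>The chord is centred at the mean angle \<open>\<theta> + d / 2\<close>; for
    negative \<open>d\<close> it starts at \<open>\<theta> + d\<close> and must be reversed.\<close>
  show ?thesis
  proof (cases "0 \<le> d")
    case True
    then show ?thesis
      using that[OF L] \<gamma> \<theta>' by (simp add: add.commute)
  next
    case False
    then show ?thesis
      using that[OF L] lip_path_reverse[OF \<gamma>] \<theta>' by (simp add: add.commute)
  qed
qed

section \<open>Minimal paths on the cup\<close>

lemma lip_path_side:
  assumes "0 \<le> \<rho>" "\<rho> \<le> \<rho>'" "\<rho>' \<le> 1 / sin \<phi>"
  shows "lip_path (conical_cup \<phi>) (\<rho>' - \<rho>) (\<lambda>t. side_point \<phi> (\<rho> + t) \<theta>)
    (side_point \<phi> \<rho> \<theta>) (side_point \<phi> \<rho>' \<theta>)"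
proof -
  have "side_point \<phi> (\<rho> + t) \<theta> \<in> conical_cup \<phi>" if "0 \<le> t" "t \<le> \<rho>' - \<rho>" for t
    using assms that by (intro side_point_in_cup) auto
  moreover have "side_point \<phi> \<rho>' \<theta> = side_point \<phi> \<rho> \<theta> + (\<rho>' - \<rho>) *\<^sub>R side_point \<phi> 1 \<theta>"
    by (simp flip: side_point_add)
  ultimately show ?thesis
    using assms unfolding side_point_add[of _ \<rho>] by (intro lip_path_straight) auto
qed

lemma lip_path_lid:
  assumes "- 1 \<le> r" "r \<le> r'" "r' \<le> 1"
  shows "lip_path (conical_cup \<phi>) (r' - r) (\<lambda>t. cyl (r + t) \<theta> (cot \<phi>))
    (cyl r \<theta> (cot \<phi>)) (cyl r' \<theta> (cot \<phi>))"
proof -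
  have "cyl (r + t) \<theta> (cot \<phi>) \<in> conical_cup \<phi>" if "0 \<le> t" "t \<le> r' - r" for t
    using assms that by (intro lid_point_in_cup) auto
  moreover have "cyl r' \<theta> (cot \<phi>) = cyl r \<theta> (cot \<phi>) + (r' - r) *\<^sub>R cyl 1 \<theta> 0"
    by (simp flip: cyl_add)
  ultimately show ?thesis
    using assms unfolding cyl_add[of r] by (intro lip_path_straight) (auto simp: norm_cyl)
qed

text \<open>\<open>m\<close> is how far the meridian of \<open>X\<close> runs along the side.
  Cutting it at distance \<open>\<rho>\<close> from the apex lets a shortcut be attached there, and
  \<open>\<rho> = 0\<close> gives the whole meridian.\<close>

lemma lip_path_meridian:
  assumes "X \<in> conical_cup \<phi>"
  obtains m \<theta> where "0 \<le> m" "m \<le> 1 / sin \<phi>" "X \<noteq> 0 \<Longrightarrow> 0 < m"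
    "\<And>\<rho>. 0 \<le> \<rho> \<Longrightarrow> \<rho> \<le> m \<Longrightarrow>
      \<exists>\<gamma>. lip_path (conical_cup \<phi>) (apex_dist X - \<rho>) \<gamma> (side_point \<phi> \<rho> \<theta>) X"
  using assms
proof (cases rule: conical_cup_cases)
  case (side m \<theta>)
  have "\<exists>\<gamma>. lip_path (conical_cup \<phi>) (apex_dist X - \<rho>) \<gamma> (side_point \<phi> \<rho> \<theta>) X"
    if "0 \<le> \<rho>" "\<rho> \<le> m" for \<rho>
    using lip_path_side[of \<rho> m \<theta>] side that apex_dist_side[of m \<theta>] by auto
  moreover have "m \<noteq> 0" if "X \<noteq> 0"
    using that side by auto
  ultimately show ?thesis
    using side that[of m \<theta>] by force
next
  case (lid r \<theta>)
  have "\<exists>\<gamma>. lip_path (conical_cup \<phi>) (apex_dist X - \<rho>) \<gamma> (side_point \<phi> \<rho> \<theta>) X"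
    if "0 \<le> \<rho>" "\<rho> \<le> 1 / sin \<phi>" for \<rho>
  proof -
    have "lip_path (conical_cup \<phi>) (1 / sin \<phi> - \<rho>) (\<lambda>t. side_point \<phi> (\<rho> + t) \<theta>)
        (side_point \<phi> \<rho> \<theta>) (cyl 1 \<theta> (cot \<phi>))"
      using lip_path_side[of \<rho> "1 / sin \<phi>" \<theta>] that rim_side_point[of \<theta>] by simp
    moreover have "lip_path (conical_cup \<phi>) (1 - r) (\<lambda>t. cyl (r + (1 - r - t)) \<theta> (cot \<phi>))
        (cyl 1 \<theta> (cot \<phi>)) X"
      using lip_path_reverse[OF lip_path_lid[of r 1 \<theta>]] lid by simp
    ultimately have "lip_path (conical_cup \<phi>) (1 / sin \<phi> - \<rho> + (1 - r))
       (\<lambda>t. if t \<le> 1 / sin \<phi> - \<rho> then side_point \<phi> (\<rho> + t) \<theta>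
            else cyl (r + (1 - r - (t - (1 / sin \<phi> - \<rho>)))) \<theta> (cot \<phi>)) (side_point \<phi> \<rho> \<theta>) X"
      by (rule lip_path_join)
    moreover have "apex_dist X - \<rho> = 1 / sin \<phi> - \<rho> + (1 - r)"
      using lid apex_dist_lid[of r \<theta>] by simp
    ultimately show ?thesis
      by metis
  qed
  then show ?thesis
    using that[of "1 / sin \<phi>" \<theta>] sin_cos_pos by simp
qed

section \<open>The characterisation of the cone point and planarity\<close>

lemma apex_not_interior:
  assumes "minimal_path (conical_cup \<phi>) a b \<gamma> A B" "0 \<in> \<gamma> ` {a..b}"
  shows "A = 0 \<or> B = 0"
proof (rule ccontr)
  assume nz: "\<not> (A = 0 \<or> B = 0)"
  have p: "a \<le> b" "continuous_on {a..b} \<gamma>" "\<gamma> ` {a..b} \<subseteq> conical_cup \<phi>" "\<gamma> a = A" "\<gamma> b = B"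
    using assms(1) by (auto simp: minimal_path_def path_on_def)
  obtain t0 where t0: "t0 \<in> {a..b}" "\<gamma> t0 = 0"
    using assms(2) by force
  have "A \<in> conical_cup \<phi>" "B \<in> conical_cup \<phi>"
    using p by auto
  \<comment> \<open>Treating the two halves of the path separately keeps the polygon through
    \<open>\<gamma> t1\<close>, the apex and \<open>\<gamma> t2\<close> in parameter order.\<close>
  obtain t1 where t1: "t1 \<in> {a..t0}" "apex_dist A \<le> norm (\<gamma> t1) + dist (\<gamma> t1) A"
  proof (rule apex_dist_le[of "\<gamma> ` {a..t0}" A])
    show "connected (\<gamma> ` {a..t0})"
      using path_image_connected[OF p(2), of a t0] t0 by simp
    show "\<gamma> ` {a..t0} \<subseteq> conical_cup \<phi>" "0 \<in> \<gamma> ` {a..t0}" "A \<in> \<gamma> ` {a..t0}"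
      using p t0 by force+
  qed (use that in auto)
  obtain t2 where t2: "t2 \<in> {t0..b}" "apex_dist B \<le> norm (\<gamma> t2) + dist (\<gamma> t2) B"
  proof (rule apex_dist_le[of "\<gamma> ` {t0..b}" B])
    show "connected (\<gamma> ` {t0..b})"
      using path_image_connected[OF p(2), of t0 b] t0 by simp
    show "\<gamma> ` {t0..b} \<subseteq> conical_cup \<phi>" "0 \<in> \<gamma> ` {t0..b}" "B \<in> \<gamma> ` {t0..b}"
      using p t0 by force+
  qed (use that in auto)
  have "ennreal (apex_dist A + apex_dist B)
      \<le> ennreal (dist (\<gamma> a) (\<gamma> t1) + dist (\<gamma> t1) (\<gamma> t0) + dist (\<gamma> t0) (\<gamma> t2) + dist (\<gamma> t2) (\<gamma> b))"
    using t1 t2 t0 p by (intro ennreal_leI) (simp add: dist_commute)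
  also have "\<dots> \<le> curve_length a b \<gamma>"
    using t0 t1 t2 by (intro polygon_le_curve_length) auto
  finally have lower: "ennreal (apex_dist A + apex_dist B) \<le> curve_length a b \<gamma>" .

  obtain mA \<theta>A where A: "0 < mA" "mA \<le> 1 / sin \<phi>"
    "\<And>\<rho>. 0 \<le> \<rho> \<Longrightarrow> \<rho> \<le> mA \<Longrightarrow>
      \<exists>\<gamma>. lip_path (conical_cup \<phi>) (apex_dist A - \<rho>) \<gamma> (side_point \<phi> \<rho> \<theta>A) A"
    using lip_path_meridian[OF \<open>A \<in> _\<close>] nz by metis
  obtain mB \<theta>B where B: "0 < mB" "mB \<le> 1 / sin \<phi>"
    "\<And>\<rho>. 0 \<le> \<rho> \<Longrightarrow> \<rho> \<le> mB \<Longrightarrow>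
      \<exists>\<gamma>. lip_path (conical_cup \<phi>) (apex_dist B - \<rho>) \<gamma> (side_point \<phi> \<rho> \<theta>B) B"
    using lip_path_meridian[OF \<open>B \<in> _\<close>] nz by metis
  \<comment> \<open>A common distance at which both meridians can be cut; the two pieces removed
    have total length \<open>2 * \<rho>\<close>, more than the chord replacing them.\<close>
  define \<rho> where "\<rho> = min mA mB"
  have \<rho>: "0 < \<rho>" "\<rho> \<le> 1 / sin \<phi>" "\<rho> \<le> mA" "\<rho> \<le> mB"
    using A B by (auto simp: \<rho>_def)
  obtain \<gamma>1 where 1: "lip_path (conical_cup \<phi>) (apex_dist A - \<rho>) \<gamma>1 (side_point \<phi> \<rho> \<theta>A) A"
    using A(3)[of \<rho>] \<rho> by auto
  obtain \<gamma>3 where 3: "lip_path (conical_cup \<phi>) (apex_dist B - \<rho>) \<gamma>3 (side_point \<phi> \<rho> \<theta>B) B"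
    using B(3)[of \<rho>] \<rho> by auto
  obtain L \<gamma>2 where 2: "L < 2 * \<rho>"
    "lip_path (conical_cup \<phi>) L \<gamma>2 (side_point \<phi> \<rho> \<theta>A) (side_point \<phi> \<rho> \<theta>B)"
    using lip_path_shortcut[OF \<rho>(1,2), of \<theta>A \<theta>B] by blast
  note competitor = lip_path_join[OF lip_path_join[OF lip_path_reverse[OF 1] 2(2)] 3]
  have "ennreal (apex_dist A + apex_dist B)
      \<le> ennreal (apex_dist A - \<rho> + L + (apex_dist B - \<rho>))"
    using lower minimal_path_le_lip_path[OF assms(1) competitor] by (rule order.trans)
  \<comment> \<open>\<open>ennreal\<close> sends negative reals to 0, so nonnegativity is what
    carries the inequality over to the reals.\<close>
  moreover have "0 \<le> apex_dist A - \<rho> + L + (apex_dist B - \<rho>)"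
    using competitor by (simp add: lip_path_def)
  ultimately show False
    using 2(1) by simp
qed

lemma interior_of_minimal_path:
  assumes "K \<in> conical_cup \<phi>" "K \<noteq> 0"
  obtains a b \<gamma> A B where "minimal_path (conical_cup \<phi>) a b \<gamma> A B" "K \<in> \<gamma> ` {a..b}" "K \<noteq> A" "K \<noteq> B"
proof -
  have s: "0 < 1 / sin \<phi>"
    using sin_cos_pos by simp
  consider (side) \<rho> \<theta> where "0 < \<rho>" "\<rho> < 1 / sin \<phi>" "K = side_point \<phi> \<rho> \<theta>"
    | (lid) r \<theta> where "0 \<le> r" "r < 1" "K = cyl r \<theta> (cot \<phi>)"
    | (rim) \<theta> where "K = cyl 1 \<theta> (cot \<phi>)"
    using assms(1)
  proof (cases rule: conical_cup_cases)
    case (side \<rho> \<theta>)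
    moreover have "\<rho> \<noteq> 0"
      using side assms(2) by auto
    ultimately show ?thesis
      using that(1)[of \<rho> \<theta>] that(3)[of \<theta>] rim_side_point[of \<theta>] by (cases "\<rho> = 1 / sin \<phi>") auto
  next
    case (lid r \<theta>)
    then show ?thesis
      using that(2)[of r \<theta>] that(3)[of \<theta>] by (cases "r = 1") auto
  qed
  then show ?thesis
  proof cases
    case side
    have l: "lip_path (conical_cup \<phi>) (1 / sin \<phi>) (\<lambda>t. side_point \<phi> t \<theta>)
        0 (side_point \<phi> (1 / sin \<phi>) \<theta>)"
      using s lip_path_side[of 0 "1 / sin \<phi>" \<theta>] by simp
    have min: "minimal_path (conical_cup \<phi>) 0 (1 / sin \<phi>) (\<lambda>t. side_point \<phi> t \<theta>)
        0 (side_point \<phi> (1 / sin \<phi>) \<theta>)"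
      using s norm_side_point[of \<phi> "1 / sin \<phi>" \<theta>]
      by (intro straight_minimal[OF l]) (auto simp del: norm_side_point)
    have "K \<noteq> side_point \<phi> (1 / sin \<phi>) \<theta>"
      using side norm_side_point[of \<phi> \<rho> \<theta>] norm_side_point[of \<phi> "1 / sin \<phi>" \<theta>] by fastforce
    then show ?thesis
      using side assms(2) by (intro that[OF min]) (auto intro!: image_eqI[of _ _ \<rho>])
  next
    \<comment> \<open>The diameter through \<open>K\<close> is straight, hence minimal;
      \<open>K\<close> sits at parameter \<open>1 + r\<close>, and \<open>0 \<le> r < 1\<close>
      keeps it off both ends.\<close>
    case lid
    have l: "lip_path (conical_cup \<phi>) 2 (\<lambda>t. cyl (- 1 + t) \<theta> (cot \<phi>))
        (cyl (- 1) \<theta> (cot \<phi>)) (cyl 1 \<theta> (cot \<phi>))"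
      using lip_path_lid[of "- 1" 1 \<theta>] by simp
    have "dist (cyl (- 1) \<theta> (cot \<phi>)) (cyl 1 \<theta> (cot \<phi>)) = norm (cyl (- 2) \<theta> 0)"
      unfolding dist_norm by (rule arg_cong[where f = norm], rule real3_eqI) auto
    then have d: "dist (cyl (- 1) \<theta> (cot \<phi>)) (cyl 1 \<theta> (cot \<phi>)) = 2"
      by (simp add: norm_cyl)
    have min: "minimal_path (conical_cup \<phi>) 0 2 (\<lambda>t. cyl (- 1 + t) \<theta> (cot \<phi>))
        (cyl (- 1) \<theta> (cot \<phi>)) (cyl 1 \<theta> (cot \<phi>))"
      using d by (intro straight_minimal[OF l]) auto
    have "K \<noteq> cyl (- 1) \<theta> (cot \<phi>)" "K \<noteq> cyl 1 \<theta> (cot \<phi>)"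
      using lid by (auto dest!: arg_cong[where f = axis_dist])
    then show ?thesis
      using lid by (intro that[OF min]) (auto intro!: image_eqI[of _ _ "1 + r"])
  next
    case rim
    \<comment> \<open>The centre of the lid, written with the angle of \<open>K\<close> so that the
      lid leg follows the radius from \<open>K\<close>. All meridian paths to the centre have the
      same length, so the one through \<open>K\<close> attains the lower bound.\<close>
    let ?B = "cyl 0 \<theta> (cot \<phi>)"
    have B: "?B \<in> conical_cup \<phi>" "?B \<noteq> 0"
      using lid_point_in_cup[of 0 \<theta>] cot_pos by (auto dest!: arg_cong[where f = "\<lambda>X. X$3"])
    have l1: "lip_path (conical_cup \<phi>) (1 / sin \<phi>) (\<lambda>t. side_point \<phi> t \<theta>) 0 K"
      using s lip_path_side[of 0 "1 / sin \<phi>" \<theta>] rim_side_point[of \<theta>] rim by auto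
    have l2: "lip_path (conical_cup \<phi>) 1 (\<lambda>t. cyl (1 - t) \<theta> (cot \<phi>)) K ?B"
      using lip_path_reverse[OF lip_path_lid[of 0 1 \<theta>]] rim by simp
    note l = lip_path_join[OF l1 l2]
    define \<delta> where "\<delta> = (\<lambda>t. if t \<le> 1 / sin \<phi> then side_point \<phi> t \<theta>
        else cyl (1 - (t - 1 / sin \<phi>)) \<theta> (cot \<phi>))"
    have min: "minimal_path (conical_cup \<phi>) 0 (1 / sin \<phi> + 1) \<delta> 0 ?B"
      unfolding \<delta>_def
    proof (rule lip_path_minimal[OF l])
      fix a b \<gamma> assume "path_on (conical_cup \<phi>) a b \<gamma> 0 ?B"
      then have p: "a \<le> b" "continuous_on {a..b} \<gamma>" "\<gamma> ` {a..b} \<subseteq> conical_cup \<phi>" "\<gamma> a = 0" "\<gamma> b = ?B"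
        by (auto simp: path_on_def)
      obtain t where t: "t \<in> {a..b}" "apex_dist ?B \<le> norm (\<gamma> t) + dist (\<gamma> t) ?B"
      proof (rule apex_dist_le[of "\<gamma> ` {a..b}" ?B])
        show "connected (\<gamma> ` {a..b})"
          using path_image_connected[OF p(2), of a b] by simp
        show "\<gamma> ` {a..b} \<subseteq> conical_cup \<phi>" "0 \<in> \<gamma> ` {a..b}" "?B \<in> \<gamma> ` {a..b}"
          using p by force+
      qed (use that in auto)
      have "ennreal (1 / sin \<phi> + 1) \<le> ennreal (dist (\<gamma> a) (\<gamma> t) + dist (\<gamma> t) (\<gamma> b))"
        using t p apex_dist_lid[of 0 \<theta>] by (intro ennreal_leI) simp
      also have "\<dots> \<le> curve_length a b \<gamma>"
        using t by (intro dist_le_curve_length) auto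
      finally show "ennreal (1 / sin \<phi> + 1) \<le> curve_length a b \<gamma>" .
    qed (use B in auto)
    have "K = \<delta> (1 / sin \<phi>)"
      using rim rim_side_point[of \<theta>] by (simp add: \<delta>_def)
    moreover have "K \<noteq> ?B"
      using rim by (auto dest!: arg_cong[where f = axis_dist])
    ultimately show ?thesis
      using assms(2) s by (intro that[OF min]) (auto intro!: image_eqI[of _ _ "1 / sin \<phi>"])
  qed
qed

text \<open>Such a path is no longer than a meridian, so every inscribed polygon is at most
  \<open>apex_dist X\<close> long, and the lower bound of \<open>apex_dist_le\<close> becomes an
  equality. Inserting any further point of the path then forces it onto one of two segments.\<close>

lemma apex_path_planar:
  assumes "minimal_path (conical_cup \<phi>) a b \<gamma> A B" "A = 0 \<or> B = 0"
  shows "\<exists>P. is_plane P \<and> cup_axis \<subseteq> P \<and> \<gamma> ` {a..b} \<subseteq> P"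
proof -
  have p: "a \<le> b" "continuous_on {a..b} \<gamma>" "\<gamma> ` {a..b} \<subseteq> conical_cup \<phi>" "\<gamma> a = A" "\<gamma> b = B" "A \<noteq> B"
    using assms(1) by (auto simp: minimal_path_def path_on_def)
  \<comment> \<open>The end other than the cone point, so that both orientations of the path are
    treated together.\<close>
  define X where "X = (if A = 0 then B else A)"
  have X: "X \<noteq> 0" "A = 0 \<and> B = X \<or> A = X \<and> B = 0"
    using assms(2) p(6) by (auto simp: X_def)
  have im: "A \<in> \<gamma> ` {a..b}" "B \<in> \<gamma> ` {a..b}"
    using p by force+
  then have "X \<in> conical_cup \<phi>"
    using p(3) X by auto
  obtain m \<theta> where "0 \<le> m"
    and m: "\<And>\<rho>. 0 \<le> \<rho> \<Longrightarrow> \<rho> \<le> m \<Longrightarrow>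
      \<exists>\<gamma>. lip_path (conical_cup \<phi>) (apex_dist X - \<rho>) \<gamma> (side_point \<phi> \<rho> \<theta>) X"
    by (rule lip_path_meridian[OF \<open>X \<in> _\<close>]) (use that in blast)
  then obtain \<delta> where "lip_path (conical_cup \<phi>) (apex_dist X) \<delta> 0 X"
    using m[of 0] by auto
  then obtain \<delta>' where \<delta>': "lip_path (conical_cup \<phi>) (apex_dist X) \<delta>' A B"
    using X(2) lip_path_reverse by metis
  then have ad0: "0 \<le> apex_dist X"
    by (simp add: lip_path_def)
  have upper: "d \<le> apex_dist X" if "ennreal d \<le> curve_length a b \<gamma>" for d
    using order.trans[OF that minimal_path_le_lip_path[OF assms(1) \<delta>']] ad0
    by (simp add: ennreal_le_iff)

  obtain u where u: "u \<in> {a..b}"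
    and R: "apex_dist X \<le> norm (\<gamma> u) + dist (\<gamma> u) X"
      "\<gamma> u $ 1 \<noteq> 0 \<or> \<gamma> u $ 2 \<noteq> 0"
      "norm (\<gamma> u) + dist (\<gamma> u) X \<le> apex_dist X \<Longrightarrow> \<gamma> u $ 1 * X$2 = \<gamma> u $ 2 * X$1"
  proof (rule apex_dist_le[of "\<gamma> ` {a..b}" X])
    show "connected (\<gamma> ` {a..b})"
      using path_image_connected[OF p(2), of a b] by simp
    show "\<gamma> ` {a..b} \<subseteq> conical_cup \<phi>" "0 \<in> \<gamma> ` {a..b}" "X \<in> \<gamma> ` {a..b}"
      using p(3) im X by auto
  qed (use that X in auto)
  define R where "R = \<gamma> u"
  \<comment> \<open>A horizontal normal orthogonal to \<open>R\<close>: its plane contains the axis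
    and \<open>R\<close>, and it is nonzero because \<open>R\<close> is off the axis.\<close>
  define n :: "real^3" where "n = vector [- (R$2), R$1, 0]"
  define P where "P = {x. n \<bullet> x = 0}"
  have inner_n: "n \<bullet> Y = R$1 * Y$2 - R$2 * Y$1" for Y
    by (simp add: n_def inner_vec_def sum_3)
  have "n \<noteq> 0"
    using R(2) by (auto simp: n_def R_def vec_eq_iff forall_3)
  then have "is_plane P"
    unfolding is_plane_def P_def by (simp add: affine_hyperplane)
  moreover have "cup_axis \<subseteq> P"
    by (auto simp: cup_axis_def P_def inner_n)
  moreover have "\<gamma> t \<in> P" if t: "t \<in> {a..b}" for t
  proof -
    have len: "norm R + dist R X \<le> apex_dist X"
      using upper[OF dist_le_curve_length[of a u b \<gamma>]] u X(2) p(4,5)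
      by (auto simp: R_def dist_commute)
    then have "X \<in> P"
      using R(3) by (simp add: P_def inner_n R_def)
    have "convex P"
      by (simp add: P_def convex_hyperplane)
    have seg: "closed_segment 0 R \<subseteq> P" "closed_segment R X \<subseteq> P"
      using \<open>X \<in> P\<close> by (intro closed_segment_subset \<open>convex P\<close>; simp add: P_def inner_n)+
    have "dist A (\<gamma> t) + dist (\<gamma> t) R + dist R B \<le> apex_dist X
        \<or> dist A R + dist R (\<gamma> t) + dist (\<gamma> t) B \<le> apex_dist X"
    proof (cases "t \<le> u")
      case True
      then show ?thesis
        using upper[OF polygon_le_curve_length[of a t u u b \<gamma>]] t u p(4,5) by (auto simp: R_def)
    next
      case False
      then show ?thesis
        using upper[OF polygon_le_curve_length[of a u t t b \<gamma>]] t u p(4,5) by (auto simp: R_def)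
    qed
    \<comment> \<open>Subtracting \<open>apex_dist X \<le> norm R + dist R X\<close> leaves equality
      in one triangle inequality; which segment it concerns depends on the orientation and on the
      order of \<open>t\<close> and \<open>u\<close>.\<close>
    then have "norm (\<gamma> t) + dist (\<gamma> t) R \<le> norm R \<or> dist R (\<gamma> t) + dist (\<gamma> t) X \<le> dist R X"
      using X(2) R(1) by (auto simp: R_def dist_commute)
    then have "between (0, R) (\<gamma> t) \<or> between (R, X) (\<gamma> t)"
      using dist_triangle[of 0 R "\<gamma> t"] dist_triangle[of R X "\<gamma> t"]
      by (auto simp: between)
    then show ?thesis
      using seg by (auto simp: between_mem_segment)
  qed
  ultimately show ?thesis
    by blast
qed

end

theorem proposition8:
  fixes \<phi> :: real
  assumes "0 < \<phi>" and "\<phi> < pi / 2"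
  shows "(\<forall>K \<in> conical_cup \<phi>.
            K = cone_point \<longleftrightarrow>
            (\<forall>a b \<gamma> A B. minimal_path (conical_cup \<phi>) a b \<gamma> A B \<and> K \<in> \<gamma> ` {a..b}
               \<longrightarrow> K = A \<or> K = B)) \<and>
         (\<forall>a b \<gamma> A B. minimal_path (conical_cup \<phi>) a b \<gamma> A B \<and> (A = cone_point \<or> B = cone_point)
            \<longrightarrow> (\<exists>P. is_plane P \<and> cup_axis \<subseteq> P \<and> \<gamma> ` {a..b} \<subseteq> P))"
proof (intro conjI ballI allI impI iffI)
  fix K a b \<gamma> A B
  assume "K = cone_point" "minimal_path (conical_cup \<phi>) a b \<gamma> A B \<and> K \<in> \<gamma> ` {a..b}"
  then show "K = A \<or> K = B"
    using apex_not_interior[OF assms, of a b \<gamma> A B] by (auto simp: cone_point_def)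
next
  fix K
  assume "K \<in> conical_cup \<phi>"
    and "\<forall>a b \<gamma> A B. minimal_path (conical_cup \<phi>) a b \<gamma> A B \<and> K \<in> \<gamma> ` {a..b} \<longrightarrow> K = A \<or> K = B"
  then show "K = cone_point"
    using interior_of_minimal_path[OF assms, of K] unfolding cone_point_def by metis
next
  fix a b \<gamma> A B
  assume "minimal_path (conical_cup \<phi>) a b \<gamma> A B \<and> (A = cone_point \<or> B = cone_point)"
  then show "\<exists>P. is_plane P \<and> cup_axis \<subseteq> P \<and> \<gamma> ` {a..b} \<subseteq> P"
    using apex_path_planar[OF assms] by (auto simp: cone_point_def)
qed

end
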